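(* Let $X$ be a non-negative absolutely continuous random variable with mean $\mu$ and (finite) variance $\sigma^2$, $\sigma>0$, whose distribution is symmetric about $\mu$. Then the cumulative residual entropy of $X$ satisfies $$\mathcal{E}(X)\leq \frac{\sigma}{\sqrt{2}}\sum_{n=1}^{+\infty}\frac{1}{n}\sqrt{\frac{1}{2n+1}-B(n+1,n+1)},$$ where $B(\cdot,\cdot)$ is the complete beta function.
   Context: $\log$ is the natural logarithm, with the convention $0\log 0=0$. The cumulative residual entropy of a non-negative absolutely continuous random variable $X$ with cumulative distribution function $F$ is $\mathcal{E}(X)=-\int_0^{+\infty}(1-F(x))\log(1-F(x))\,dx$. The distribution of $X$ is symmetric about $\mu$ if $X-\mu$ and $\mu-X$ have the same distribution. The complete beta function is $B(a,b)=\int_0^1 t^{a-1}(1-t)^{b-1}\,dt$. *)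

theory Defs
  imports "HOL-Probability.Probability"
begin

text \<open>
  The library sets \<open>ln 0 = 0\<close>, so the convention \<open>0 * log 0 = 0\<close> holds. As the Bochner
  integral of a non-integrable function is 0, integrability is treated separately.
\<close>

definition cre_integrand :: "'a measure \<Rightarrow> ('a \<Rightarrow> real) \<Rightarrow> real \<Rightarrow> real" where
  "cre_integrand M X x =
     (1 - cdf (distr M borel X) x) * ln (1 - cdf (distr M borel X) x)"

definition cumulative_residual_entropy :: "'a measure \<Rightarrow> ('a \<Rightarrow> real) \<Rightarrow> real" where
  "cumulative_residual_entropy M X = - (LINT x:{0..}|lborel. cre_integrand M X x)"

text \<open>The null-set form of absolute continuity; by Radon-Nikodym it means having a density.\<close>

definition absolutely_continuous_rv :: "'a measure \<Rightarrow> ('a \<Rightarrow> real) \<Rightarrow> bool" where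
  "absolutely_continuous_rv M X \<longleftrightarrow>
     X \<in> borel_measurable M \<and> absolutely_continuous lborel (distr M borel X)"

definition symmetric_about :: "'a measure \<Rightarrow> ('a \<Rightarrow> real) \<Rightarrow> real \<Rightarrow> bool" where
  "symmetric_about M X \<mu> \<longleftrightarrow>
     distr M borel (\<lambda>\<omega>. X \<omega> - \<mu>) = distr M borel (\<lambda>\<omega>. \<mu> - X \<omega>)"

text \<open>The library defines \<open>Beta\<close> through \<open>Gamma\<close>; it is the complete beta integral:\<close>

lemma Beta_real_eq_integral:
  fixes a b :: real
  assumes "a > 0" "b > 0"
  shows "Beta a b = integral {0..1} (\<lambda>t. t powr (a - 1) * (1 - t) powr (b - 1))"
  using has_integral_Beta_real[OF assms] by (simp add: integral_unique)

lemma absolutely_continuous_rv_iff_density: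
  assumes "prob_space M"
  shows "absolutely_continuous_rv M X \<longleftrightarrow> (\<exists>f. distributed M lborel X f)"
proof
  assume "absolutely_continuous_rv M X"
  then have X: "X \<in> borel_measurable M"
    and ac: "absolutely_continuous lborel (distr M borel X)"
    by (auto simp: absolutely_continuous_rv_def)
  have "\<exists>f\<in>borel_measurable lborel. density lborel f = distr M borel X"
    using sigma_finite_measure.Radon_Nikodym[OF sigma_finite_lborel ac] by simp
  then obtain f where "f \<in> borel_measurable lborel" "density lborel f = distr M borel X"
    by blast
  moreover have "distr M lborel X = distr M borel X"
    by (rule distr_cong) auto
  ultimately show "\<exists>f. distributed M lborel X f"
    using X by (intro exI[of _ f]) (simp add: distributed_def)
next
  assume "\<exists>f. distributed M lborel X f"
  then obtain f where f: "distributed M lborel X f" by blast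
  have "distr M borel X = distr M lborel X"
    by (rule distr_cong) auto
  with f show "absolutely_continuous_rv M X"
    by (auto simp: absolutely_continuous_rv_def distributed_def
        intro!: absolutely_continuousI_density)
qed

end

theory Submission
  imports Defs
begin

text \<open>
  Let \<open>F\<close> be the distribution function of \<open>X\<close>. Since \<open>X\<close> has no atoms, \<open>F\<close> is continuous and
  \<open>F X\<close> is uniform on \<open>[0, 1]\<close> (\<open>distr_cdf_eq_uniform\<close>).

  The entropy integrand is split by the identity
  \<open>-(1 - u) ln (1 - u) = (\<Sum>n\<ge>1. (u - u^(n + 1)) / (n (n + 1)))\<close> on \<open>[0, 1]\<close>
  (\<open>neg_mult_ln_sums\<close>). It is chosen because each term integrates to a covariance: writing
  \<open>X\<close> as the integral of the indicator of \<open>x < X\<close> over \<open>x \<ge> 0\<close> and exchanging integrals yields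
  \<open>\<integral>\<^bsub>0\<^esub>\<^bsup>\<infinity>\<^esup> (F x - F x^(n + 1)) / (n + 1) dx = E ((X - \<mu>) (F X)^n)\<close>
  (\<open>integral_cdf_power_diff\<close>).

  Symmetry says that \<open>X\<close> and \<open>2 \<mu> - X\<close> have the same distribution and that
  \<open>F (2 \<mu> - x) = 1 - F x\<close>. Only the part of \<open>u^n\<close> that is odd about \<open>u = 1/2\<close> therefore
  contributes, and the covariance equals \<open>E ((X - \<mu>) (U^n - (1 - U)^n)) / 2\<close> with \<open>U = F X\<close>.
  By Cauchy--Schwarz it is at most \<open>\<sigma>/2\<close> times the square root of
  \<open>\<integral>\<^bsub>0\<^esub>\<^bsup>1\<^esup> (u^n - (1 - u)^n)\<^sup>2 du = 2 (1/(2n + 1) - B(n + 1, n + 1))\<close>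
  (\<open>symmetric_covariance_bound\<close>), which is the term of the asserted series up to the factor
  \<open>1/n\<close>.

  The terms of the expansion are non-negative and their integrals are dominated by a series with
  terms of order \<open>n powr (-3/2)\<close>. Sum and integral may thus be exchanged, which gives
  integrability of the entropy integrand together with the bound.
\<close>

section \<open>The Cauchy--Schwarz inequality for integrals\<close>

lemma Cauchy_Schwarz_integral:
  fixes f g :: "'a \<Rightarrow> real"
  assumes fg: "integrable M (\<lambda>x. f x * g x)"
    and f: "integrable M (\<lambda>x. (f x)\<^sup>2)" and g: "integrable M (\<lambda>x. (g x)\<^sup>2)"
  shows "(\<integral>x. f x * g x \<partial>M)\<^sup>2 \<le> (\<integral>x. (f x)\<^sup>2 \<partial>M) * (\<integral>x. (g x)\<^sup>2 \<partial>M)"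
proof -
  define A B C where "A = (\<integral>x. (f x)\<^sup>2 \<partial>M)" and "B = (\<integral>x. (g x)\<^sup>2 \<partial>M)"
    and "C = (\<integral>x. f x * g x \<partial>M)"
  \<comment> \<open>The integral of \<open>(f - t g)\<^sup>2\<close>; the value of \<open>t\<close> is chosen according to whether \<open>B = 0\<close>.\<close>
  have quadratic_nonneg: "0 \<le> A - 2 * t * C + t\<^sup>2 * B" for t
  proof -
    have "0 \<le> (\<integral>x. (f x - t * g x)\<^sup>2 \<partial>M)"
      by simp
    also have "\<dots> = (\<integral>x. (f x)\<^sup>2 - 2 * t * (f x * g x) + t\<^sup>2 * (g x)\<^sup>2 \<partial>M)"
      by (rule Bochner_Integration.integral_cong) (auto simp: power2_eq_square algebra_simps)
    also have "\<dots> = A - 2 * t * C + t\<^sup>2 * B"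
      using fg f g by (simp add: A_def B_def C_def)
    finally show ?thesis .
  qed
  have "C\<^sup>2 \<le> A * B"
  proof (cases "B = 0")
    case True
    have "C = 0"
    proof (rule ccontr)
      assume "C \<noteq> 0"
      with quadratic_nonneg[of "(A + 1) / (2 * C)"] True show False
        by simp
    qed
    with True show ?thesis by simp
  next
    case False
    moreover have "0 \<le> B" by (simp add: B_def)
    ultimately have "B > 0" by simp
    with quadratic_nonneg[of "C / B"] show ?thesis
      by (simp add: field_simps power2_eq_square)
  qed
  then show ?thesis by (simp add: A_def B_def C_def)
qed

section \<open>The probability integral transform\<close>

text \<open>
  Continuity makes \<open>cdf M\<close> attain every \<open>v\<close> strictly between 0 and 1. If \<open>cdf M x = v\<close>, then
  monotonicity traps the half-line \<open>{..x}\<close>, of probability \<open>v\<close>, between the events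
  \<open>cdf M y < v\<close> and \<open>cdf M y \<le> v\<close>. The event \<open>cdf M y \<le> u\<close> lies in
  \<open>cdf M y < v\<close> for every \<open>v > u\<close>, which supplies the missing upper bound, also at \<open>u = 0\<close>.
\<close>

lemma (in real_distribution) distr_cdf_eq_uniform:
  assumes no_atoms: "\<And>x. prob {x} = 0"
  shows "distr M borel (cdf M) = uniform_measure lborel {0..1}"
proof (rule cdf_unique)
  interpret finite_borel_measure M by (rule finite_borel_measure_M)
  have cont: "continuous_on UNIV (cdf M)"
    using no_atoms isCont_cdf continuous_at_imp_continuous_on by blast
  then have [measurable]: "cdf M \<in> borel_measurable M"
    by (simp add: borel_measurable_continuous_onI)
  show "real_distribution (distr M borel (cdf M))" by simp
  show "real_distribution (uniform_measure lborel {0..1})"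
    by (auto intro!: real_distribution.intro prob_space_uniform_measure
        simp: real_distribution_axioms_def)
  have cdf_attains: "\<exists>x. cdf M x = v" if "0 < v" "v < 1" for v
  proof -
    have "\<forall>\<^sub>F x in at_bot. cdf M x < v"
      using that by (intro order_tendstoD(2)[OF cdf_lim_at_bot]) auto
    then obtain a where a: "\<And>x. x \<le> a \<Longrightarrow> cdf M x < v"
      by (auto simp: eventually_at_bot_linorder)
    have "\<forall>\<^sub>F x in at_top. v < cdf M x"
      using that by (intro order_tendstoD(1)[OF cdf_lim_at_top_prob]) auto
    then obtain b where b: "\<And>x. x \<ge> b \<Longrightarrow> v < cdf M x"
      by (auto simp: eventually_at_top_linorder)
    have "\<exists>x\<ge>min a b. x \<le> max a b \<and> cdf M x = v"
      using a[of "min a b"] b[of "max a b"] cont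
      by (intro IVT') (auto intro: continuous_on_subset)
    then show ?thesis by blast
  qed
  have less: "prob {x. cdf M x < v} \<le> v" if "0 < v" "v < 1" for v
  proof -
    obtain x where x: "cdf M x = v" using cdf_attains[OF \<open>0 < v\<close> \<open>v < 1\<close>] by blast
    have "prob {y. cdf M y < v} \<le> prob {..x}"
      using cdf_nondecreasing x by (intro finite_measure_mono) (auto, meson not_le linear)
    then show ?thesis using x by (simp add: cdf_def)
  qed
  have atMost: "prob {x. cdf M x \<le> u} = u" if "0 \<le> u" "u < 1" for u
  proof (rule antisym)
    show "prob {x. cdf M x \<le> u} \<le> u"
    proof (rule field_le_epsilon)
      fix e :: real assume "0 < e"
      define v where "v = min (u + e) ((u + 1) / 2)"
      have v: "u < v" "v < 1" "v \<le> u + e" using that \<open>0 < e\<close> by (auto simp: v_def min_def)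
      have "prob {x. cdf M x \<le> u} \<le> prob {x. cdf M x < v}"
        using v by (intro finite_measure_mono) auto
      also have "\<dots> \<le> v" using less v that by auto
      finally show "prob {x. cdf M x \<le> u} \<le> u + e" using v by simp
    qed
    show "u \<le> prob {x. cdf M x \<le> u}"
    proof (cases "u = 0")
      case False
      then obtain x where x: "cdf M x = u" using cdf_attains[of u] \<open>0 \<le> u\<close> \<open>u < 1\<close> by auto
      have "prob {..x} \<le> prob {y. cdf M y \<le> u}"
        using cdf_nondecreasing x by (intro finite_measure_mono) auto
      then show ?thesis using x by (simp add: cdf_def)
    qed simp
  qed
  show "cdf (distr M borel (cdf M)) = cdf (uniform_measure lborel {0..1})"
  proof
    fix u :: real
    have L: "cdf (distr M borel (cdf M)) u = prob {x. cdf M x \<le> u}"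
      by (simp add: cdf_def[of "distr _ _ _"] measure_distr vimage_def)
    have R: "cdf (uniform_measure lborel {0..1}) u = measure lborel ({0..1} \<inter> {..u})"
      by (simp add: cdf_def)
    consider "u < 0" | "0 \<le> u" "u < 1" | "1 \<le> u" by linarith
    then show "cdf (distr M borel (cdf M)) u = cdf (uniform_measure lborel {0..1}) u"
    proof cases
      case 1
      then have "{x. cdf M x \<le> u} = {}" "{0..1} \<inter> {..u} = {}"
        using cdf_nonneg by (auto simp: not_le intro: less_le_trans)
      then show ?thesis by (simp add: L R)
    next
      case 2
      then have "{0..1} \<inter> {..u} = {0..u}" by auto
      then show ?thesis using 2 by (simp add: L R atMost)
    next
      case 3
      then have "{x. cdf M x \<le> u} = space M" "{0..1} \<inter> {..u} = {0..1}"
        using cdf_bounded_prob by (auto intro: order_trans)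
      then show ?thesis unfolding L R using prob_space by simp
    qed
  qed
qed

lemma (in real_distribution) borel_measurable_cdf [measurable]: "cdf M \<in> borel_measurable borel"
  by (intro borel_measurable_mono monoI finite_borel_measure.cdf_nondecreasing
      finite_borel_measure_M)

lemma (in real_distribution) integral_cdf_eq:
  fixes h :: "real \<Rightarrow> real"
  assumes no_atoms: "\<And>x. prob {x} = 0"
    and h: "h \<in> borel_measurable borel"
  shows "(\<integral>x. h (cdf M x) \<partial>M) = (LINT u:{0..1}|lborel. h u)"
proof -
  have "(\<integral>x. h (cdf M x) \<partial>M) = (\<integral>u. h u \<partial>distr M borel (cdf M))"
    using h by (subst integral_distr) auto
  also have "\<dots> = (\<integral>u. h u \<partial>uniform_measure lborel {0..1})"
    by (simp add: distr_cdf_eq_uniform[OF no_atoms])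
  also have "uniform_measure lborel {0..1} = density lborel (\<lambda>u. ennreal (indicator {0..1::real} u))"
    by (auto simp: uniform_measure_def indicator_def intro!: density_cong)
  also have "(\<integral>u. h u \<partial>\<dots>) = (LINT u:{0..1}|lborel. h u)"
    using h by (subst integral_density) (auto simp: set_lebesgue_integral_def)
  finally show ?thesis .
qed

text \<open>
  The half-line \<open>{x<..}\<close> contains the event \<open>cdf M x < cdf M y\<close>, and both have probability
  \<open>1 - cdf M x\<close>; they differ by a null set, where \<open>cdf M\<close> is flat to the right of \<open>x\<close>. So the
  integrand is almost surely a function of \<open>cdf M y\<close> alone, and the integral is one of \<open>u ^ n\<close>
  over \<open>[cdf M x, 1]\<close>.
\<close>

lemma (in real_distribution) integral_cdf_power_tail:
  assumes no_atoms: "\<And>x. prob {x} = 0"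
  shows "(\<integral>y. indicator {x<..} y * cdf M y ^ n \<partial>M) = (1 - cdf M x ^ Suc n) / (n + 1)"
proof -
  interpret finite_borel_measure M by (rule finite_borel_measure_M)
  let ?F = "cdf M"
  have F: "0 \<le> ?F y" "?F y \<le> 1" for y using cdf_nonneg cdf_bounded_prob by auto
  have tail: "prob {x<..} = 1 - ?F x"
  proof -
    have "{x<..} = space M - {..x}" by auto
    then show ?thesis using prob_compl[of "{..x}"] by (simp only: cdf_def) simp
  qed
  have tail': "prob {y. ?F x < ?F y} = 1 - ?F x"
  proof -
    have "prob {y. ?F x < ?F y} = (\<integral>y. indicator {?F x<..} (?F y) \<partial>M)"
      by (subst Bochner_Integration.integral_cong[OF refl, where g = "indicator {y. ?F x < ?F y}"])
         (auto simp: indicator_def)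
    also have "\<dots> = (LINT u:{0..1}|lborel. indicator {?F x<..} u)"
      by (rule integral_cdf_eq[OF no_atoms]) simp
    also have "\<dots> = (\<integral>u. indicator {?F x<..1} u \<partial>lborel)"
      unfolding set_lebesgue_integral_def
      using F[of x] by (intro Bochner_Integration.integral_cong) (auto simp: indicator_def)
    also have "\<dots> = 1 - ?F x" using F[of x] by simp
    finally show ?thesis .
  qed
  have sub: "{y. ?F x < ?F y} \<subseteq> {x<..}"
    using cdf_nondecreasing by (auto simp: not_le[symmetric])
  have "prob ({x<..} - {y. ?F x < ?F y}) = 0"
    using sub by (subst finite_measure_Diff) (auto simp: tail tail')
  then have "AE y in M. y \<notin> {x<..} - {y. ?F x < ?F y}"
    by (intro AE_not_in) (auto simp: null_sets_def emeasure_eq_measure)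
  then have AE: "AE y in M. indicator {x<..} y * ?F y ^ n = indicator {?F x<..} (?F y) * ?F y ^ n"
    by eventually_elim (use sub in \<open>auto simp: indicator_def\<close>)
  have "(\<integral>y. indicator {x<..} y * ?F y ^ n \<partial>M) = (\<integral>y. indicator {?F x<..} (?F y) * ?F y ^ n \<partial>M)"
    using AE by (intro integral_cong_AE) auto
  also have "\<dots> = (LINT u:{0..1}|lborel. indicator {?F x<..} u * u ^ n)"
    by (rule integral_cdf_eq[OF no_atoms]) simp
  also have "\<dots> = (\<integral>u. u ^ n * indicator {?F x..1} u \<partial>lborel)"
    unfolding set_lebesgue_integral_def using F[of x]
    by (intro integral_cong_AE)
       (auto intro!: AE_I'[where N = "{?F x}"] simp: indicator_def)
  also have "\<dots> = (1 ^ Suc n - ?F x ^ Suc n) / Suc n"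
    using F[of x] by (intro integral_power) auto
  finally show ?thesis by simp
qed

section \<open>The covariance of a random variable and a power of its distribution function\<close>

text \<open>
  A case of Hoeffding's covariance formula. Replacing \<open>y\<close> by the length of \<open>{0..<y}\<close> turns
  the right-hand side into a double integral. For fixed \<open>x\<close> the inner integral over \<open>y > x\<close> is
  known from \<open>integral_cdf_power_tail\<close>: it is
  \<open>(1 - F^(n + 1))/(n + 1) - (1 - F)/(n + 1)\<close> with \<open>F = cdf M x\<close>. Centring the power of
  \<open>cdf M\<close> instead of \<open>y\<close> keeps the weight \<open>y\<close> non-negative.
\<close>

lemma (in real_distribution) integral_cdf_power_diff:
  assumes no_atoms: "\<And>x. prob {x} = 0"
    and nonneg: "AE y in M. 0 \<le> y"
    and int: "integrable M (\<lambda>y. y)"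
  shows "set_integrable lborel {0..} (\<lambda>x. (cdf M x - cdf M x ^ Suc n) / (n + 1))" (is ?I)
    and "(LINT x:{0..}|lborel. (cdf M x - cdf M x ^ Suc n) / (n + 1)) =
      (\<integral>y. (y - expectation (\<lambda>y. y)) * cdf M y ^ n \<partial>M)" (is ?E)
proof -
  interpret finite_borel_measure M by (rule finite_borel_measure_M)
  interpret pair_sigma_finite M lborel ..
  let ?F = "cdf M"
  have F: "0 \<le> ?F y" "?F y \<le> 1" for y using cdf_nonneg cdf_bounded_prob by auto
  \<comment> \<open>\<open>1 / (n + 1)\<close> is the mean of \<open>?F y ^ n\<close>, the \<open>n\<close>-th moment of the uniform distribution.\<close>
  define G where "G y = ?F y ^ n - 1 / (n + 1)" for y
  have [measurable]: "G \<in> borel_measurable borel"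
    unfolding G_def by measurable
  have G_bound: "\<bar>G y\<bar> \<le> 1" for y
  proof -
    have "0 \<le> ?F y ^ n" "?F y ^ n \<le> 1" using F by (auto intro: power_le_one)
    moreover have "0 \<le> 1 / real (n + 1)" "1 / real (n + 1) \<le> 1" by auto
    ultimately show ?thesis unfolding G_def abs_le_iff by linarith
  qed
  define k where "k y x = indicator {0..<y} x * G y" for y x :: real
  have k_measurable: "case_prod k \<in> borel_measurable (M \<Otimes>\<^sub>M lborel)"
  proof -
    have "case_prod k = (\<lambda>p. (if 0 \<le> snd p \<and> snd p < fst p then 1 else 0) * G (fst p))"
      by (auto simp: k_def fun_eq_iff indicator_def)
    then show ?thesis by simp
  qed
  have k_int: "(\<integral>x. k y x \<partial>lborel) = y * G y" if "0 \<le> y" for y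
    using that by (simp add: k_def)
  have k_int_norm: "(\<integral>x. norm (k y x) \<partial>lborel) = y * \<bar>G y\<bar>" if "0 \<le> y" for y
    using that by (simp add: k_def abs_mult)
  have int_pow: "integrable M (\<lambda>y. y * ?F y ^ n)"
    using F by (auto intro!: Bochner_Integration.integrable_bound[OF int]
        simp: abs_mult mult_left_le power_le_one)
  have [simp]: "integrable M (\<lambda>y. y * G y)" "integrable M (\<lambda>y. y * \<bar>G y\<bar>)"
    using G_bound
    by (auto intro!: Bochner_Integration.integrable_bound[OF int] 
        simp: abs_mult mult_left_le)
  have k_integrable: "integrable (M \<Otimes>\<^sub>M lborel) (case_prod k)"
  proof (rule Fubini_integrable[OF k_measurable])
    have "AE y in M. y * \<bar>G y\<bar> = (\<integral>x. norm (case (y, x) of (y, x) \<Rightarrow> k y x) \<partial>lborel)"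
      using nonneg by eventually_elim (simp only: k_int_norm prod.case)
    moreover have "(\<lambda>y. \<integral>x. norm (case (y, x) of (y, x) \<Rightarrow> k y x) \<partial>lborel) \<in> borel_measurable M"
      using k_measurable by (intro lborel.borel_measurable_lebesgue_integral)
        (simp add: case_prod_beta')
    ultimately show "integrable M (\<lambda>y. \<integral>x. norm (case (y, x) of (y, x) \<Rightarrow> k y x) \<partial>lborel)"
      by (intro integrable_cong_AE_imp[OF \<open>integrable M (\<lambda>y. y * \<bar>G y\<bar>)\<close>])
        (auto elim: eventually_mono)
    have "integrable lborel (\<lambda>x. k y x)" for y
    proof -
      have "integrable lborel (indicator {0..<y} :: real \<Rightarrow> real)"
        by (rule integrable_real_indicator) (cases "0 \<le> y"; simp)+
      then show ?thesis unfolding k_def by (rule integrable_mult_left)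
    qed
    then show "AE y in M. integrable lborel (\<lambda>x. case (y, x) of (y, x) \<Rightarrow> k y x)"
      by simp
  qed
  have k_inner: "(\<integral>y. k y x \<partial>M) = indicator {0..} x * ((?F x - ?F x ^ Suc n) / (n + 1))" for x
  proof -
    have "(\<integral>y. k y x \<partial>M) = (\<integral>y. indicator {0..} x *
        (indicator {x<..} y * ?F y ^ n - indicator {x<..} y * (?F y ^ 0 / (n + 1))) \<partial>M)"
      by (rule Bochner_Integration.integral_cong) (auto simp: k_def G_def indicator_def)
    also have "\<dots> = indicator {0..} x *
        ((\<integral>y. indicator {x<..} y * ?F y ^ n \<partial>M) -
         (\<integral>y. indicator {x<..} y * ?F y ^ 0 \<partial>M) / (n + 1))"
    proof -
      have "integrable M (\<lambda>y. indicator {x<..} y * ?F y ^ m)" for m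
        using F by (intro integrable_const_bound[of _ 1])
          (auto simp: indicator_def power_le_one)
      from this[of n] this[of 0] show ?thesis
        by simp
    qed
    also have "\<dots> = indicator {0..} x * ((1 - ?F x ^ Suc n) / (n + 1) - (1 - ?F x) / (n + 1))"
      using integral_cdf_power_tail[OF no_atoms, of x n] integral_cdf_power_tail[OF no_atoms, of x 0]
      by (simp only: power_0 power_one_right One_nat_def[symmetric]) simp
    also have "\<dots> = indicator {0..} x * ((?F x - ?F x ^ Suc n) / (n + 1))"
      by (simp add: diff_divide_distrib)
    finally show ?thesis .
  qed
  show ?I
    using integrable_snd[OF k_integrable] unfolding k_inner set_integrable_def by simp
  have "(LINT x:{0..}|lborel. (?F x - ?F x ^ Suc n) / (n + 1)) = (\<integral>x. (\<integral>y. k y x \<partial>M) \<partial>lborel)"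
    unfolding k_inner set_lebesgue_integral_def by simp
  also have "\<dots> = (\<integral>y. (\<integral>x. k y x \<partial>lborel) \<partial>M)"
    by (rule Fubini_integral[OF k_integrable])
  also have "\<dots> = (\<integral>y. y * G y \<partial>M)"
  proof (rule integral_cong_AE)
    show "(\<lambda>y. \<integral>x. k y x \<partial>lborel) \<in> borel_measurable M"
      using k_measurable by measurable
    show "AE y in M. (\<integral>x. k y x \<partial>lborel) = y * G y"
      using nonneg by eventually_elim (simp add: k_int)
  qed simp
  also have "\<dots> = (\<integral>y. y * ?F y ^ n - y / (n + 1) \<partial>M)"
    by (simp add: G_def right_diff_distrib)
  also have "\<dots> = (\<integral>y. y * ?F y ^ n \<partial>M) - expectation (\<lambda>y. y) / (n + 1)"
    using int int_pow by simp
  also have "expectation (\<lambda>y. y) / (n + 1) = (\<integral>y. expectation (\<lambda>y. y) * ?F y ^ n \<partial>M)"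
  proof -
    have "(\<integral>y. ?F y ^ n \<partial>M) = (LINT u:{0..1}|lborel. u ^ n)"
      by (rule integral_cdf_eq[OF no_atoms]) simp
    also have "\<dots> = (\<integral>u. u ^ n * indicator {0..1} u \<partial>lborel)"
      by (simp add: set_lebesgue_integral_def mult.commute)
    also have "\<dots> = 1 / (n + 1)"
      by (subst integral_power) auto
    finally show ?thesis by simp
  qed
  also have "(\<integral>y. y * ?F y ^ n \<partial>M) - (\<integral>y. expectation (\<lambda>y. y) * ?F y ^ n \<partial>M) =
      (\<integral>y. (y - expectation (\<lambda>y. y)) * ?F y ^ n \<partial>M)"
  proof -
    have "integrable M (\<lambda>y. ?F y ^ n)"
      using F by (auto intro!: integrable_const_bound[of _ 1] simp: power_le_one)
    then show ?thesis using int_pow by (simp add: left_diff_distrib)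
  qed
  finally show ?E .
qed

section \<open>The bound on the covariance under symmetry\<close>

text \<open>
  The two squares contribute \<open>1 / (2 * n + 1)\<close> each, and the mixed term is the beta integral.
\<close>

lemma set_integral_power_diff_squared:
  fixes n :: nat
  defines "b \<equiv> 1 / (2 * real n + 1) - Beta (real n + 1) (real n + 1)"
  shows "(LINT u:{0..1}|lborel. (u ^ n - (1 - u) ^ n)\<^sup>2) = 2 * b"
proof -
  have powers: "((\<lambda>u::real. u ^ (2 * n) + (1 - u) ^ (2 * n)) has_integral 2 / (2 * real n + 1)) {0..1}"
  proof -
    define G where "G u = (u ^ Suc (2 * n) - (1 - u) ^ Suc (2 * n)) / (2 * real n + 1)" for u :: real
    have "(G has_real_derivative u ^ (2 * n) + (1 - u) ^ (2 * n)) (at u within {0..1})" for u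
      unfolding G_def
      by (rule derivative_eq_intros refl | simp)+ (simp add: field_simps)
    then have "((\<lambda>u. u ^ (2 * n) + (1 - u) ^ (2 * n)) has_integral G 1 - G 0) {0..1}"
      by (intro fundamental_theorem_of_calculus)
        (auto simp: has_real_derivative_iff_has_vector_derivative)
    moreover have "G 1 - G 0 = 2 / (2 * real n + 1)"
      by (simp add: G_def)
    ultimately show ?thesis by simp
  qed
  have mixed: "((\<lambda>u::real. u ^ n * (1 - u) ^ n) has_integral Beta (real n + 1) (real n + 1)) {0..1}"
    using has_integral_Beta_real[of "real n + 1" "real n + 1"]
    \<comment> \<open>For \<open>n = 0\<close> the integrands differ at the endpoints, because \<open>0 powr 0 = 0\<close> but \<open>0 ^ 0 = 1\<close>.\<close>
    by (rule has_integral_spike_finite[of "{0, 1}", rotated 2]) (auto simp: powr_realpow)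
  have "((\<lambda>u::real. u ^ (2 * n) + (1 - u) ^ (2 * n) - 2 * (u ^ n * (1 - u) ^ n)) has_integral
      2 / (2 * real n + 1) - 2 * Beta (real n + 1) (real n + 1)) {0..1}"
    by (intro has_integral_diff powers has_integral_mult_right mixed)
  also have "(\<lambda>u::real. u ^ (2 * n) + (1 - u) ^ (2 * n) - 2 * (u ^ n * (1 - u) ^ n)) =
      (\<lambda>u. (u ^ n - (1 - u) ^ n)\<^sup>2)"
    by (rule ext) (simp add: power2_diff mult_ac flip: power_mult)
  finally have "integral {0..1} (\<lambda>u::real. (u ^ n - (1 - u) ^ n)\<^sup>2) = 2 * b"
    by (simp add: integral_unique b_def)
  moreover have "set_integrable lborel {0..1} (\<lambda>u::real. (u ^ n - (1 - u) ^ n)\<^sup>2)"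
    by (intro borel_integrable_atLeastAtMost') (auto intro!: continuous_intros)
  ultimately show ?thesis
    by (simp add: set_borel_integral_eq_integral)
qed

lemma Beta_Suc_Suc_le:
  fixes n :: nat
  shows "Beta (real n + 1) (real n + 1) \<le> 1 / (2 * real n + 1)"
proof -
  have "0 \<le> (LINT u:{0..1::real}|lborel. (u ^ n - (1 - u) ^ n)\<^sup>2)"
    by (simp add: set_lebesgue_integral_def)
  then show ?thesis
    by (simp add: set_integral_power_diff_squared)
qed

lemma (in real_distribution) cdf_reflect:
  assumes no_atoms: "\<And>x. prob {x} = 0"
    and sym: "distr M borel (\<lambda>y. 2 * m - y) = M"
  shows "cdf M (2 * m - x) = 1 - cdf M x"
proof -
  have "cdf M (2 * m - x) = measure (distr M borel (\<lambda>y. 2 * m - y)) {..2 * m - x}"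
    by (simp add: cdf_def sym)
  also have "\<dots> = prob {x..}"
    by (subst measure_distr) (auto intro!: arg_cong[of _ _ prob])
  also have "{x..} = space M - ({..x} - {x})" by auto
  also have "prob \<dots> = 1 - prob ({..x} - {x})"
    by (rule prob_compl) simp
  also have "prob ({..x} - {x}) = cdf M x"
    using no_atoms by (subst finite_measure_Diff) (auto simp: cdf_def)
  finally show ?thesis .
qed

text \<open>
  The substitution \<open>y \<mapsto> 2 * m - y\<close> preserves \<open>M\<close>, negates \<open>y - m\<close> and turns \<open>cdf M\<close> into
  \<open>1 - cdf M\<close>. Averaging the integral with its image replaces \<open>cdf M y ^ n\<close> by half the
  difference \<open>g y\<close> below. Applying Cauchy--Schwarz only after this step is what produces the
  beta term.
\<close>

lemma (in real_distribution) symmetric_covariance_bound: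
  assumes no_atoms: "\<And>x. prob {x} = 0"
    and sym: "distr M borel (\<lambda>y. 2 * m - y) = M"
    and int: "integrable M (\<lambda>y. y)"
    and int2: "integrable M (\<lambda>y. (y - m)\<^sup>2)"
  shows "(\<integral>y. (y - m) * cdf M y ^ n \<partial>M) \<le> sqrt (\<integral>y. (y - m)\<^sup>2 \<partial>M) / sqrt 2 *
    sqrt (1 / (2 * real n + 1) - Beta (real n + 1) (real n + 1))"
proof -
  interpret finite_borel_measure M by (rule finite_borel_measure_M)
  let ?F = "cdf M"
  have F: "0 \<le> ?F y" "?F y \<le> 1" for y using cdf_nonneg cdf_bounded_prob by auto
  define b where "b = 1 / (2 * real n + 1) - Beta (real n + 1) (real n + 1)"
  define V where "V = (\<integral>y. (y - m)\<^sup>2 \<partial>M)"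
  define g where "g y = ?F y ^ n - (1 - ?F y) ^ n" for y
  have [measurable]: "g \<in> borel_measurable borel"
    unfolding g_def by measurable
  have g_bound: "\<bar>g y\<bar> \<le> 1" for y
  proof -
    have "0 \<le> ?F y ^ n" "?F y ^ n \<le> 1" "0 \<le> (1 - ?F y) ^ n" "(1 - ?F y) ^ n \<le> 1"
      using F by (auto intro: power_le_one)
    then show ?thesis unfolding g_def abs_le_iff by linarith
  qed
  have int': "integrable M (\<lambda>y. y - m)" using int by simp
  have int_pow: "integrable M (\<lambda>y. (y - m) * ?F y ^ n)" "integrable M (\<lambda>y. (y - m) * (1 - ?F y) ^ n)"
    using F by (auto intro!: Bochner_Integration.integrable_bound[OF int']
        simp: abs_mult mult_left_le power_le_one)
  have "(\<integral>y. (y - m) * ?F y ^ n \<partial>M) =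
      (\<integral>y. (y - m) * ?F y ^ n \<partial>distr M borel (\<lambda>y. 2 * m - y))"
    by (simp add: sym)
  also have "\<dots> = (\<integral>y. (2 * m - y - m) * ?F (2 * m - y) ^ n \<partial>M)"
    by (rule integral_distr) auto
  also have "\<dots> = - (\<integral>y. (y - m) * (1 - ?F y) ^ n \<partial>M)"
    unfolding cdf_reflect[OF no_atoms sym]
    by (simp flip: Bochner_Integration.integral_minus add: algebra_simps)
  finally have "2 * (\<integral>y. (y - m) * ?F y ^ n \<partial>M) = (\<integral>y. (y - m) * g y \<partial>M)"
    using int_pow by (simp add: g_def right_diff_distrib)
  moreover have "(\<integral>y. (y - m) * g y \<partial>M) \<le> sqrt (V * (2 * b))"
  proof -
    have "(\<integral>y. (y - m) * g y \<partial>M)\<^sup>2 \<le> V * (\<integral>y. (g y)\<^sup>2 \<partial>M)"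
      unfolding V_def
    proof (rule Cauchy_Schwarz_integral[OF _ int2])
      show "integrable M (\<lambda>y. (y - m) * g y)"
        using g_bound by (auto intro!: Bochner_Integration.integrable_bound[OF int']
            simp: abs_mult mult_left_le)
      show "integrable M (\<lambda>y. (g y)\<^sup>2)"
        using g_bound by (auto intro!: integrable_const_bound[of _ 1] simp: abs_square_le_1)
    qed
    also have "(\<integral>y. (g y)\<^sup>2 \<partial>M) = 2 * b"
      unfolding g_def b_def set_integral_power_diff_squared[symmetric]
      by (rule integral_cdf_eq[OF no_atoms]) simp
    finally show ?thesis by (rule real_le_rsqrt)
  qed
  moreover have "sqrt (V * (2 * b)) = 2 * (sqrt V / sqrt 2 * sqrt b)"
    by (simp add: real_sqrt_mult real_div_sqrt field_simps)
  ultimately show ?thesis by (simp add: V_def b_def)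
qed

section \<open>The series expansion of the entropy integrand\<close>

text \<open>
  With \<open>1 / ((n + 1) (n + 2)) = 1 / (n + 1) - 1 / (n + 2)\<close> the series splits into a telescoping
  one and two copies of the logarithmic series for \<open>L = - ln (1 - u)\<close>, one multiplied by \<open>u\<close> and
  one without its first term. At \<open>u = 1\<close>, where the logarithmic series diverges, both sides vanish.
\<close>

lemma neg_mult_ln_sums:
  fixes u :: real
  assumes "0 \<le> u" "u \<le> 1"
  shows "(\<lambda>n. (u - u ^ (n + 2)) / (real (n + 1) * real (n + 2))) sums (- ((1 - u) * ln (1 - u)))"
proof (cases "u = 1")
  case True
  then show ?thesis by simp
next
  case False
  define L where "L = - ln (1 - u)"
  have "(\<lambda>n. - ((- (- u)) ^ n) / of_nat n) sums ln (1 + (- u))"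
    by (rule ln_series') (use assms False in auto)
  from sums_minus[OF this] have L0: "(\<lambda>n. u ^ n / real n) sums L"
    by (simp add: L_def)
  have L1: "(\<lambda>n. u ^ (n + 1) / real (n + 1)) sums L"
    using L0 sums_Suc_iff[of "\<lambda>n. u ^ n / real n" L] by simp
  have L2: "(\<lambda>n. u ^ (n + 2) / real (n + 2)) sums (L - u)"
    using L1 sums_Suc_iff[of "\<lambda>n. u ^ (n + 1) / real (n + 1)" "L - u"] by simp
  have "(\<lambda>n. 1 / real (Suc n)) \<longlonglongrightarrow> 0"
    using LIMSEQ_inverse_real_of_nat by (simp add: inverse_eq_divide)
  from telescope_sums'[OF this] have T: "(\<lambda>n. 1 / real (n + 1) - 1 / real (n + 2)) sums 1"
    by simp
  have "(\<lambda>n. u * (1 / real (n + 1) - 1 / real (n + 2)) - u * (u ^ (n + 1) / real (n + 1))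
      + u ^ (n + 2) / real (n + 2)) sums (u * 1 - u * L + (L - u))"
    by (intro sums_add sums_diff sums_mult T L1 L2)
  also have "(\<lambda>n. u * (1 / real (n + 1) - 1 / real (n + 2)) - u * (u ^ (n + 1) / real (n + 1))
      + u ^ (n + 2) / real (n + 2)) = (\<lambda>n. (u - u ^ (n + 2)) / (real (n + 1) * real (n + 2)))"
  proof
    fix n
    have partial_fractions: "u * (1 / r - 1 / (r + 1)) - u * (p / r) + u * p / (r + 1) =
        (u - u * p) / (r * (r + 1))" if "r > 0" for r p :: real
      using that by (simp add: divide_simps) (simp add: algebra_simps)
    have "real (n + 2) = real (n + 1) + 1" "u ^ (n + 2) = u * u ^ (n + 1)" by auto
    then show "u * (1 / real (n + 1) - 1 / real (n + 2)) - u * (u ^ (n + 1) / real (n + 1))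
      + u ^ (n + 2) / real (n + 2) = (u - u ^ (n + 2)) / (real (n + 1) * real (n + 2))"
      using partial_fractions[of "real (n + 1)" "u ^ (n + 1)"] by (simp only: of_nat_0_less_iff)
  qed
  also have "u * 1 - u * L + (L - u) = - ((1 - u) * ln (1 - u))"
    by (simp add: L_def algebra_simps)
  finally show ?thesis .
qed

lemma summable_sqrt_Beta_coefficients:
  "summable (\<lambda>n. 1 / real (Suc n) *
     sqrt (1 / (2 * real (Suc n) + 1) - Beta (real (Suc n) + 1) (real (Suc n) + 1)))"
proof (rule summable_comparison_test')
  show "summable (\<lambda>n. real (Suc n) powr (-3/2))"
    by (subst summable_Suc_iff) (simp add: summable_real_powr_iff)
  fix n :: nat
  let ?x = "real (Suc n)"
  have "0 < Beta (?x + 1) (?x + 1)" by (simp add: Beta_def Gamma_real_pos)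
  moreover have "1 / (2 * ?x + 1) \<le> 1 / ?x" by (simp add: field_simps)
  ultimately have "1 / ?x * sqrt (1 / (2 * ?x + 1) - Beta (?x + 1) (?x + 1)) \<le> 1 / ?x * sqrt (1 / ?x)"
    by (intro mult_left_mono real_sqrt_le_mono) auto
  also have "\<dots> = ?x powr (-1) * ?x powr (- (1/2))"
    unfolding powr_minus_divide by (simp add: powr_half_sqrt real_sqrt_divide)
  also have "\<dots> = ?x powr (-3/2)"
    by (subst powr_add[symmetric]) simp
  finally show "norm (1 / ?x * sqrt (1 / (2 * ?x + 1) - Beta (?x + 1) (?x + 1))) \<le> ?x powr (-3/2)"
    using Beta_Suc_Suc_le[of "Suc n"] by simp
qed

section \<open>The entropy bound\<close>

lemma (in real_distribution) symmetric_entropy_bound: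
  assumes no_atoms: "\<And>x. prob {x} = 0"
    and nonneg: "AE y in M. 0 \<le> y"
    and int: "integrable M (\<lambda>y. y)"
    and int2: "integrable M (\<lambda>y. y\<^sup>2)"
    and mean: "expectation (\<lambda>y. y) = m"
    and sym: "distr M borel (\<lambda>y. 2 * m - y) = M"
  defines "c \<equiv> \<lambda>n::nat. 1 / real n *
    sqrt (1 / (2 * real n + 1) - Beta (real n + 1) (real n + 1))"
  shows "set_integrable lborel {0..} (\<lambda>x. (1 - cdf M x) * ln (1 - cdf M x))" (is ?I)
    and "- (LINT x:{0..}|lborel. (1 - cdf M x) * ln (1 - cdf M x)) \<le>
      sqrt (variance (\<lambda>y. y)) / sqrt 2 * (\<Sum>n. c (Suc n))" (is ?B)
proof -
  interpret finite_borel_measure M by (rule finite_borel_measure_M)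
  let ?F = "cdf M"
  have F: "0 \<le> ?F y" "?F y \<le> 1" for y using cdf_nonneg cdf_bounded_prob by auto
  define K where "K = sqrt (variance (\<lambda>y. y)) / sqrt 2"
  \<comment> \<open>Indices are shifted by one: \<open>f n\<close> belongs to the power \<open>Suc n\<close> in the covariance.\<close>
  define f where "f n x = indicator {0..} x * ((?F x - ?F x ^ (n + 2)) / (real (n + 1) * real (n + 2)))"
    for n :: nat and x
  have f_nonneg: "0 \<le> f n x" for n x
    using F[of x] power_decreasing[of 1 "n + 2" "?F x"] by (simp add: f_def)
  have f_sums: "(\<lambda>n. f n x) sums (- (indicator {0..} x * ((1 - ?F x) * ln (1 - ?F x))))" for x
    using sums_mult[OF neg_mult_ln_sums[OF F], of "indicator {0..} x" x] by (simp add: f_def)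
  have int_dev: "integrable M (\<lambda>y. (y - m)\<^sup>2)"
    using int int2 by (simp add: power2_diff)
  have f_alt: "f n x = 1 / real (Suc n) *
      (indicator {0..} x * ((?F x - ?F x ^ Suc (Suc n)) / real (Suc n + 1)))" for n x
    by (simp add: f_def)
  have f_integrable: "integrable lborel (f n)" for n
    unfolding f_alt using integral_cdf_power_diff(1)[OF no_atoms nonneg int, of "Suc n"]
    by (intro integrable_mult_right) (simp add: set_integrable_def)
  have f_integral: "(\<integral>x. f n x \<partial>lborel) \<le> K * c (Suc n)" for n
  proof -
    have "(\<integral>x. f n x \<partial>lborel) = 1 / real (Suc n) *
        (LINT x:{0..}|lborel. (?F x - ?F x ^ Suc (Suc n)) / real (Suc n + 1))"
      unfolding f_alt set_lebesgue_integral_def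
      by (subst Bochner_Integration.integral_mult_right_zero) simp
    also have "\<dots> = 1 / real (Suc n) * (\<integral>y. (y - m) * ?F y ^ Suc n \<partial>M)"
      using integral_cdf_power_diff(2)[OF no_atoms nonneg int, of "Suc n"] mean by simp
    also have "\<dots> \<le> 1 / real (Suc n) * (K * sqrt (1 / (2 * real (Suc n) + 1) -
        Beta (real (Suc n) + 1) (real (Suc n) + 1)))"
      unfolding K_def mean using symmetric_covariance_bound[OF no_atoms sym int int_dev, of "Suc n"]
      by (intro mult_left_mono) auto
    finally show ?thesis by (simp add: c_def mult_ac)
  qed
  have summable_c: "summable (\<lambda>n. c (Suc n))"
    unfolding c_def by (rule summable_sqrt_Beta_coefficients)
  have summable_f: "summable (\<lambda>n. \<integral>x. f n x \<partial>lborel)"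
  proof (rule summable_comparison_test')
    show "summable (\<lambda>n. K * c (Suc n))" using summable_c by (rule summable_mult)
    show "norm (\<integral>x. f n x \<partial>lborel) \<le> K * c (Suc n)" for n
      using f_integral f_nonneg by simp
  qed
  have sums_f: "AE x in lborel. summable (\<lambda>n. norm (f n x))"
    using f_sums f_nonneg by (auto simp: sums_iff)
  have eq: "(\<Sum>n. f n x) = - (indicator {0..} x *\<^sub>R ((1 - ?F x) * ln (1 - ?F x)))" for x
    using f_sums by (simp add: sums_iff)
  have "integrable lborel (\<lambda>x. - (\<Sum>n. f n x))"
    using summable_f f_nonneg by (intro Bochner_Integration.integrable_minus integrable_suminf[OF f_integrable sums_f]) simp
  then show ?I
    unfolding eq set_integrable_def by simp
  have "(\<integral>x. (\<Sum>n. f n x) \<partial>lborel) = (\<Sum>n. \<integral>x. f n x \<partial>lborel)"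
    using summable_f f_nonneg by (intro integral_suminf[OF f_integrable sums_f]) simp
  also have "\<dots> \<le> (\<Sum>n. K * c (Suc n))"
    by (intro suminf_le f_integral summable_f summable_mult summable_c)
  also have "\<dots> = K * (\<Sum>n. c (Suc n))"
    using summable_c by (rule suminf_mult)
  finally show ?B
    unfolding eq K_def set_lebesgue_integral_def by simp
qed

theorem theorem4:
  fixes M :: "'a measure" and X :: "'a \<Rightarrow> real" and \<mu> \<sigma> :: real
  assumes "prob_space M"
    and "absolutely_continuous_rv M X"
    and "AE \<omega> in M. 0 \<le> X \<omega>"
    and "integrable M X"
    and "prob_space.expectation M X = \<mu>"
    and "integrable M (\<lambda>\<omega>. (X \<omega>)\<^sup>2)"
    and "prob_space.variance M X = \<sigma>\<^sup>2"
    and "\<sigma> > 0"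
    and "symmetric_about M X \<mu>"
  shows "let c = (\<lambda>n::nat. 1 / real n *
            sqrt (1 / (2 * real n + 1) - Beta (real n + 1) (real n + 1)))
    in set_integrable lborel {0..} (cre_integrand M X)
      \<and> summable (\<lambda>n. c (Suc n))
      \<and> cumulative_residual_entropy M X \<le> \<sigma> / sqrt 2 * (\<Sum>n. c (Suc n))"
proof -
  interpret prob_space M by fact
  define D where "D = distr M borel X"
  have [measurable]: "X \<in> borel_measurable M"
    and ac: "absolutely_continuous lborel D"
    using assms(2) by (auto simp: absolutely_continuous_rv_def D_def)
  interpret D: real_distribution D
    unfolding D_def by simp
  have no_atoms: "D.prob {x} = 0" for x
  proof -
    have "{x} \<in> null_sets D" using ac by (auto simp: absolutely_continuous_def intro: finite_imp_null_set_lborel)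
    then show ?thesis by (simp add: measure_def null_sets_def)
  qed
  have nonneg: "AE y in D. 0 \<le> y"
    unfolding D_def using assms(3) by (subst AE_distr_iff) auto
  have int: "integrable D (\<lambda>y. y)" "integrable D (\<lambda>y. y\<^sup>2)"
    unfolding D_def using assms(4,6) by (simp_all add: integrable_distr_eq)
  have mean: "D.expectation (\<lambda>y. y) = \<mu>"
    unfolding D_def using assms(5) by (simp add: integral_distr)
  have var: "D.variance (\<lambda>y. y) = \<sigma>\<^sup>2"
    unfolding mean using assms(5,7) by (simp add: D_def integral_distr)
  have sym: "distr D borel (\<lambda>y. 2 * \<mu> - y) = D"
  proof -
    have "distr D borel (\<lambda>y. 2 * \<mu> - y) = distr M borel (\<lambda>\<omega>. \<mu> + (\<mu> - X \<omega>))"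
      by (simp add: D_def distr_distr o_def algebra_simps)
    also have "\<dots> = distr (distr M borel (\<lambda>\<omega>. \<mu> - X \<omega>)) borel (\<lambda>y. \<mu> + y)"
      by (simp add: distr_distr o_def)
    also have "\<dots> = distr (distr M borel (\<lambda>\<omega>. X \<omega> - \<mu>)) borel (\<lambda>y. \<mu> + y)"
      using assms(9) by (simp add: symmetric_about_def)
    also have "\<dots> = D"
      by (simp add: D_def distr_distr o_def)
    finally show ?thesis .
  qed
  have cre: "cre_integrand M X = (\<lambda>x. (1 - cdf D x) * ln (1 - cdf D x))"
    by (simp add: cre_integrand_def D_def fun_eq_iff)
  show ?thesis
    using D.symmetric_entropy_bound[OF no_atoms nonneg int mean sym] summable_sqrt_Beta_coefficients
      \<open>\<sigma> > 0\<close>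
    by (simp only: Let_def cumulative_residual_entropy_def cre var real_sqrt_abs) simp
qed

end
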